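(* For every positive integer $d$ there exist constants $A_d$ and $B_d$, depending only on $d$ (and in particular not on the number of variables $n$), such that for every positive integer $n$ and every convex form $p$ in $n$ variables of degree $2d$, $$Q_p(\mathbf{x}, \mathbf{y}) \le A_d \sqrt{p(\mathbf{x})\, p(\mathbf{y})} \quad \forall\, \mathbf{x}, \mathbf{y} \in \mathbb{R}^n,$$ and $$|p(\mathbf{z})| \le B_d\, Q_p(\mathbf{z}, \bar{\mathbf{z}}) \quad \forall\, \mathbf{z} \in \mathbb{C}^n,$$ where $Q_p$ is the biform associated with $p$.
   Context: A form is a homogeneous real polynomial. A form $p$ in $n$ variables is convex if its Hessian $\nabla^2 p(\mathbf{x})$ is positive semidefinite for all $\mathbf{x} \in \mathbb{R}^n$ (convex forms of positive even degree are nonnegative on $\mathbb{R}^n$). For a form $p$ of degree $2d$ in $n$ variables, $T_p$ denotes the unique symmetric multilinear form of order $2d$ with $p(\mathbf{x}) = T_p(\mathbf{x}, \dots, \mathbf{x})$ for all $\mathbf{x} \in \mathbb{R}^n$, extended complex-multilinearly to $\mathbb{C}^n$. The biform associated with $p$ is $$Q_p(\mathbf{x}, \mathbf{y}) = T_p(\underbrace{\mathbf{x}, \dots, \mathbf{x}}_{d}, \underbrace{\mathbf{y}, \dots, \mathbf{y}}_{d}).$$ For $\mathbf{z} \in \mathbb{C}^n$, $\bar{\mathbf{z}}$ is the entrywise complex conjugate, $p(\mathbf{z})$ is the value of the polynomial $p$ at $\mathbf{z}$, and $Q_p(\mathbf{z}, \bar{\mathbf{z}})$ is a real number. *)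

theory Defs
  imports
    "HOL-Analysis.Analysis"
    "HOL-Library.Poly_Mapping"
    "HOL-Library.Multiset"
    "Jordan_Normal_Form.Matrix"
begin

(* Vectors of R^n and C^n are the elements of carrier_vec n, so that the dimension n
   is an ordinary natural number and can be quantified over inside a formula. *)

(* A monomial is a finitely supported map from variable indices to exponents; a
   polynomial is a finitely supported map from monomials to coefficients. *)
type_synonym real_mpoly = "(nat \<Rightarrow>\<^sub>0 nat) \<Rightarrow>\<^sub>0 real"

definition poly_eval :: "real_mpoly \<Rightarrow> 'a::{real_algebra_1,comm_ring_1} vec \<Rightarrow> 'a" where
  "poly_eval p x =
     (\<Sum>m\<in>Poly_Mapping.keys p. of_real (Poly_Mapping.lookup p m) *
        (\<Prod>i\<in>Poly_Mapping.keys m. (x $ i) ^ Poly_Mapping.lookup m i))"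

(* As usual, the zero polynomial counts as a form of every degree. *)
definition is_form :: "nat \<Rightarrow> nat \<Rightarrow> real_mpoly \<Rightarrow> bool" where
  "is_form n k p \<longleftrightarrow>
     (\<forall>m\<in>Poly_Mapping.keys p. Poly_Mapping.keys m \<subseteq> {..<n} \<and>
        (\<Sum>i\<in>Poly_Mapping.keys m. Poly_Mapping.lookup m i) = k)"

definition partial_deriv :: "nat \<Rightarrow> nat \<Rightarrow> (real vec \<Rightarrow> real) \<Rightarrow> real vec \<Rightarrow> real" where
  "partial_deriv n i f x = deriv (\<lambda>t. f (x + t \<cdot>\<^sub>v unit_vec n i)) 0"

definition hessian :: "nat \<Rightarrow> (real vec \<Rightarrow> real) \<Rightarrow> real vec \<Rightarrow> real mat" where
  "hessian n f x = mat n n (\<lambda>(i, j). partial_deriv n i (partial_deriv n j f) x)"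

definition psd_mat :: "nat \<Rightarrow> real mat \<Rightarrow> bool" where
  "psd_mat n M \<longleftrightarrow> M \<in> carrier_mat n n \<and> transpose_mat M = M \<and>
     (\<forall>v\<in>carrier_vec n. 0 \<le> v \<bullet> (M *\<^sub>v v))"

definition convex_form :: "nat \<Rightarrow> nat \<Rightarrow> real_mpoly \<Rightarrow> bool" where
  "convex_form n k p \<longleftrightarrow> is_form n k p \<and>
     (\<forall>x\<in>carrier_vec n. psd_mat n (hessian n (poly_eval p) x))"

definition vec_tuples :: "nat \<Rightarrow> nat \<Rightarrow> 'a vec list set" where
  "vec_tuples n k = {xs. length xs = k \<and> set xs \<subseteq> carrier_vec n}"

(* The k arguments are passed as a list. Extensionality fixes the values outside the
   domain, so that a multilinear form is determined by its values on vec_tuples n k. *)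
definition multilinear_form :: "nat \<Rightarrow> nat \<Rightarrow> ('a::field vec list \<Rightarrow> 'a) \<Rightarrow> bool" where
  "multilinear_form n k T \<longleftrightarrow> T \<in> extensional (vec_tuples n k) \<and>
     (\<forall>xs\<in>vec_tuples n k. \<forall>i<k. \<forall>u\<in>carrier_vec n. \<forall>v\<in>carrier_vec n.
        T (xs[i := u + v]) = T (xs[i := u]) + T (xs[i := v])) \<and>
     (\<forall>xs\<in>vec_tuples n k. \<forall>i<k. \<forall>v\<in>carrier_vec n. \<forall>c.
        T (xs[i := c \<cdot>\<^sub>v v]) = c * T (xs[i := v]))"

(* Two lists are rearrangements of each other iff their multisets agree. *)
definition symmetric_form :: "nat \<Rightarrow> nat \<Rightarrow> ('a vec list \<Rightarrow> 'b) \<Rightarrow> bool" where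
  "symmetric_form n k T \<longleftrightarrow>
     (\<forall>xs\<in>vec_tuples n k. \<forall>ys\<in>vec_tuples n k. mset xs = mset ys \<longrightarrow> T xs = T ys)"

(* For a form p of degree k in n variables there is exactly one such T. *)
definition polar_form :: "nat \<Rightarrow> nat \<Rightarrow> real_mpoly \<Rightarrow> real vec list \<Rightarrow> real" where
  "polar_form n k p = (THE T. multilinear_form n k T \<and> symmetric_form n k T \<and>
     (\<forall>x\<in>carrier_vec n. poly_eval p x = T (replicate k x)))"

(* The unique complex multilinear form that agrees with T on real vectors. *)
definition complex_extension ::
    "nat \<Rightarrow> nat \<Rightarrow> (real vec list \<Rightarrow> real) \<Rightarrow> complex vec list \<Rightarrow> complex" where
  "complex_extension n k T = (THE S. multilinear_form n k S \<and>
     (\<forall>xs\<in>vec_tuples n k. S (map (map_vec complex_of_real) xs) = complex_of_real (T xs)))"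

definition biform :: "nat \<Rightarrow> nat \<Rightarrow> real_mpoly \<Rightarrow> real vec \<Rightarrow> real vec \<Rightarrow> real" where
  "biform n d p x y = polar_form n (2 * d) p (replicate d x @ replicate d y)"

definition complex_biform ::
    "nat \<Rightarrow> nat \<Rightarrow> real_mpoly \<Rightarrow> complex vec \<Rightarrow> complex vec \<Rightarrow> complex" where
  "complex_biform n d p z w =
     complex_extension n (2 * d) (polar_form n (2 * d) p) (replicate d z @ replicate d w)"

end

theory Submission
  imports Defs "HOL-Combinatorics.Multiset_Permutations"
begin

text \<open>
  Positive semidefiniteness of the Hessian says \<open>T\<^sub>p(x, \<dots>, x, v, v) \<ge> 0\<close>. This gives both \<open>p \<ge> 0\<close>
  (take \<open>v = x\<close>) and convexity of \<open>p\<close> along lines, hence \<open>p(x + y) \<le> 2 ^ (2d - 1) (p(x) + p(y))\<close>.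

  Up to a binomial factor, \<open>Q\<^sub>p(x, y)\<close> is the coefficient of \<open>t ^ d\<close> in \<open>p(x + t y)\<close>. On \<open>[0, 1]\<close>
  this polynomial is at most a constant times \<open>p(x) + p(y)\<close>, and so are its coefficients.
  Replacing \<open>(x, y)\<close> by \<open>(c x, y / c)\<close> does not change \<open>Q\<^sub>p\<close>, and optimizing over \<open>c\<close> turns the
  sum into the geometric mean.

  The second inequality needs only \<open>p \<ge> 0\<close>. For \<open>|w| = 1\<close> the vector \<open>w z + cnj (w z)\<close> is real and
  \<open>p(w z + cnj (w z)) = (\<Sum>i\<le>2d. (2d choose i) w ^ (2d - 2i) T\<^sub>p(z, \<dots>, z, cnj z, \<dots>, cnj z))\<close>,
  with \<open>i\<close> arguments \<open>cnj z\<close>. Averaged over suitable roots of unity \<open>w\<close>, this gives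
  \<open>(2d choose d) Q\<^sub>p(z, cnj z)\<close>; averaged with the weight \<open>w ^ (-2d)\<close> it gives \<open>p(z)\<close>. So
  \<open>B\<^sub>d = (2d choose d)\<close> works.
\<close>

unbundle no vec_syntax

section \<open>Coefficients of real polynomials bounded on the unit interval\<close>

text \<open>
  Passing from \<open>P(t)\<close> to \<open>P(t / 2) - P(t) / 2 ^ j\<close> removes the term in \<open>t ^ j\<close> and at most doubles
  the bound on \<open>[0, 1]\<close>.
\<close>

lemma coeff_bound:
  fixes J :: "nat set" and k :: nat
  assumes "finite J" "k \<notin> J"
  shows "\<exists>C\<ge>0. \<forall>a :: nat \<Rightarrow> real. \<forall>M.
    (\<forall>t\<in>{0..1}. \<bar>\<Sum>i\<in>insert k J. a i * t ^ i\<bar> \<le> M) \<longrightarrow> \<bar>a k\<bar> \<le> C * M"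
  using assms
proof (induction J rule: finite_induct)
  case empty
  have "\<bar>a k\<bar> \<le> 1 * M" if "\<forall>t\<in>{0..1}. \<bar>\<Sum>i\<in>insert k {}. a i * t ^ i\<bar> \<le> M"
    for a :: "nat \<Rightarrow> real" and M
    using bspec[OF that, of 1] by simp
  then show ?case
    by (intro exI[of _ 1] conjI allI impI) simp_all
next
  case (insert j J)
  have "k \<notin> J"
    using insert.prems by simp
  from insert.IH[OF this] obtain C where C: "C \<ge> 0" and bound: "\<And>a :: nat \<Rightarrow> real. \<And>M.
    (\<forall>t\<in>{0..1}. \<bar>\<Sum>i\<in>insert k J. a i * t ^ i\<bar> \<le> M) \<Longrightarrow> \<bar>a k\<bar> \<le> C * M"
    by blast
  define c :: "nat \<Rightarrow> real" where "c i = (1/2) ^ i - (1/2) ^ j" for i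
  have "c k \<noteq> 0"
    using insert.prems power_inject_exp'[of "1/2 :: real" k j]
    by (simp add: c_def)
  \<comment> \<open>The transformed polynomial is bounded by \<open>2 * M\<close> and its
    coefficient at \<open>t ^ k\<close> is \<open>a k * c k\<close>; dividing by
    \<open>\<bar>c k\<bar>\<close> gives the new constant.\<close>
  show ?case
  proof (intro exI[of _ "C * 2 / \<bar>c k\<bar>"] conjI allI impI)
    fix a :: "nat \<Rightarrow> real" and M
    assume M: "\<forall>t\<in>{0..1}. \<bar>\<Sum>i\<in>insert k (insert j J). a i * t ^ i\<bar> \<le> M"
    define P where "P t = (\<Sum>i\<in>insert k (insert j J). a i * t ^ i)" for t
    have "\<bar>\<Sum>i\<in>insert k J. (a i * c i) * t ^ i\<bar> \<le> 2 * M" if t: "t \<in> {0..1}" for t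
    proof -
      have "(\<Sum>i\<in>insert k J. (a i * c i) * t ^ i) = (\<Sum>i\<in>insert k (insert j J). (a i * c i) * t ^ i)"
        using insert by (intro sum.mono_neutral_left) (auto simp: c_def)
      also have "\<dots> = P (t / 2) - (1/2) ^ j * P t"
        by (simp add: P_def c_def sum_distrib_left algebra_simps power_divide flip: sum_subtractf)
      finally have eq: "(\<Sum>i\<in>insert k J. (a i * c i) * t ^ i) = P (t / 2) - (1/2) ^ j * P t" .
      have 1: "\<bar>P (t / 2)\<bar> \<le> M"
        using bspec[OF M, of "t / 2"] t by (simp add: P_def)
      have 2: "\<bar>P t\<bar> \<le> M"
        using bspec[OF M t] by (simp add: P_def)
      have "\<bar>(1/2) ^ j * P t\<bar> \<le> 1 * \<bar>P t\<bar>"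
        unfolding abs_mult by (intro mult_right_mono) (simp_all add: power_le_one)
      with 1 2 eq show ?thesis by linarith
    qed
    then have "\<bar>a k * c k\<bar> \<le> C * (2 * M)"
      by (intro bound) blast
    then have "\<bar>a k\<bar> * \<bar>c k\<bar> \<le> C * 2 * M"
      by (simp add: abs_mult)
    then show "\<bar>a k\<bar> \<le> C * 2 / \<bar>c k\<bar> * M"
      using \<open>c k \<noteq> 0\<close> by (simp add: pos_le_divide_eq)
  qed (use C in simp)
qed

section \<open>Symmetric multilinear forms: expansion and polarization\<close>

lemma symmetric_formD:
  assumes "symmetric_form n k T" "length xs = k" "set xs \<subseteq> carrier_vec n" "mset xs = mset ys"
  shows "T xs = T ys"
proof -
  have "xs \<in> vec_tuples n k" "ys \<in> vec_tuples n k"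
    using assms(2,3) mset_eq_length[OF assms(4)] mset_eq_setD[OF assms(4)]
    by (simp_all add: vec_tuples_def)
  then show ?thesis
    using assms(1,4) unfolding symmetric_form_def by blast
qed

lemma multilinear_form_add:
  assumes "multilinear_form n k T" "Suc (length xs + length ys) = k"
    "set xs \<subseteq> carrier_vec n" "set ys \<subseteq> carrier_vec n" "u \<in> carrier_vec n" "v \<in> carrier_vec n"
  shows "T (xs @ (u + v) # ys) = T (xs @ u # ys) + T (xs @ v # ys)"
proof -
  have "xs @ u # ys \<in> vec_tuples n k" "length xs < k"
    using assms by (auto simp: vec_tuples_def)
  then have "T ((xs @ u # ys)[length xs := u + v]) =
      T ((xs @ u # ys)[length xs := u]) + T ((xs @ u # ys)[length xs := v])"
    using assms(1,5,6) unfolding multilinear_form_def by blast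
  then show ?thesis by simp
qed

lemma multilinear_form_smult:
  assumes "multilinear_form n k T" "Suc (length xs + length ys) = k"
    "set xs \<subseteq> carrier_vec n" "set ys \<subseteq> carrier_vec n" "v \<in> carrier_vec n"
  shows "T (xs @ (c \<cdot>\<^sub>v v) # ys) = c * T (xs @ v # ys)"
proof -
  have "xs @ v # ys \<in> vec_tuples n k" "length xs < k"
    using assms by (auto simp: vec_tuples_def)
  then have "T ((xs @ v # ys)[length xs := c \<cdot>\<^sub>v v]) = c * T ((xs @ v # ys)[length xs := v])"
    using assms(1,5) unfolding multilinear_form_def by blast
  then show ?thesis by simp
qed

lemma multilinear_form_replicate_smult:
  assumes "multilinear_form n k T" "length xs + j + length ys = k"
    "set xs \<subseteq> carrier_vec n" "set ys \<subseteq> carrier_vec n" "v \<in> carrier_vec n"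
  shows "T (xs @ replicate j (c \<cdot>\<^sub>v v) @ ys) = c ^ j * T (xs @ replicate j v @ ys)"
  using assms(2-)
proof (induction j arbitrary: xs)
  case (Suc j)
  have "T (xs @ replicate (Suc j) (c \<cdot>\<^sub>v v) @ ys) = c * T ((xs @ [v]) @ replicate j (c \<cdot>\<^sub>v v) @ ys)"
    using multilinear_form_smult[OF assms(1), of xs "replicate j (c \<cdot>\<^sub>v v) @ ys" v c] Suc.prems
    by (auto simp: subset_iff)
  also have "T ((xs @ [v]) @ replicate j (c \<cdot>\<^sub>v v) @ ys) = c ^ j * T ((xs @ [v]) @ replicate j v @ ys)"
    using Suc.prems by (intro Suc.IH) auto
  finally show ?case by simp
qed simp

lemma multilinear_form_expand:
  assumes "multilinear_form n k T" "Suc (length xs + length ys) = k"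
    "set xs \<subseteq> carrier_vec n" "set ys \<subseteq> carrier_vec n" "v \<in> carrier_vec n"
  shows "T (xs @ v # ys) = (\<Sum>i<n. v $ i * T (xs @ unit_vec n i # ys))"
proof -
  \<comment> \<open>\<open>w m\<close> is \<open>v\<close> truncated to its first \<open>m\<close>
    coordinates, so each induction step adds one multiple of a unit vector.\<close>
  define w where "w m = vec n (\<lambda>i. if i < m then v $ i else 0)" for m
  have "T (xs @ w m # ys) = (\<Sum>i<m. v $ i * T (xs @ unit_vec n i # ys))" if "m \<le> n" for m
    using that
  proof (induction m)
    case 0
    \<comment> \<open>The zero vector is a zero multiple of itself, so homogeneity makes the form
      vanish there.\<close>
    have "w 0 = 0 \<cdot>\<^sub>v w 0"
      by (auto simp: w_def)
    then have "T (xs @ w 0 # ys) = T (xs @ (0 \<cdot>\<^sub>v w 0) # ys)"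
      by (rule arg_cong)
    also have "\<dots> = 0"
      by (subst multilinear_form_smult[OF assms(1-4)]) (auto simp: w_def)
    finally show ?case by simp
  next
    case (Suc m)
    have w: "w (Suc m) = w m + v $ m \<cdot>\<^sub>v unit_vec n m"
      using Suc.prems by (auto simp: w_def unit_vec_def less_Suc_eq)
    have "T (xs @ w (Suc m) # ys) = T (xs @ w m # ys) + v $ m * T (xs @ unit_vec n m # ys)"
      unfolding w using assms(1-4)
      by (subst multilinear_form_add[OF assms(1)])
         (auto simp: w_def multilinear_form_smult[OF assms(1)])
    then show ?case
      using Suc by simp
  qed
  moreover have "w n = v"
    using assms(5) by (auto simp: w_def)
  ultimately show ?thesis
    by (metis order_refl)
qed

text \<open>Splitting one argument \<open>x + t \<cdot>\<^sub>v y\<close> gives two sums, which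
  Pascal's rule combines. The tail \<open>ys\<close> is arbitrary because symmetry lets it absorb
  the vector split off at each step.\<close>

lemma multilinear_form_binomial:
  fixes T :: "'a::field vec list \<Rightarrow> 'a"
  assumes T: "multilinear_form n k T" "symmetric_form n k T"
    and "j + length ys = k" "set ys \<subseteq> carrier_vec n"
    and x: "x \<in> carrier_vec n" and y: "y \<in> carrier_vec n"
  shows "T (replicate j (x + t \<cdot>\<^sub>v y) @ ys) =
    (\<Sum>i\<le>j. of_nat (j choose i) * T (replicate (j - i) x @ replicate i y @ ys) * t ^ i)"
  using assms(3,4)
proof (induction j arbitrary: ys)
  case (Suc j)
  define w where "w = x + t \<cdot>\<^sub>v y"
  have w: "w \<in> carrier_vec n"
    using x y by (simp add: w_def)
  define F where "F i = T (replicate (Suc j - i) x @ replicate i y @ ys)" for i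
  have "T (replicate (Suc j) w @ ys) = T (replicate j w @ w # ys)"
    using Suc.prems w by (intro symmetric_formD[OF T(2)]) (auto simp: subset_iff)
  also have "\<dots> = T (replicate j w @ x # ys) + t * T (replicate j w @ y # ys)"
    using Suc.prems w x y
    by (subst w_def, subst multilinear_form_add[OF T(1)])
       (auto simp: subset_iff multilinear_form_smult[OF T(1)])
  also have "T (replicate j w @ x # ys) = (\<Sum>i\<le>j. of_nat (j choose i) * F i * t ^ i)"
    unfolding w_def using Suc.prems x y
    by (subst Suc.IH)
       (auto intro!: sum.cong symmetric_formD[OF T(2)] simp: F_def subset_iff Suc_diff_le)
  also have "T (replicate j w @ y # ys) = (\<Sum>i\<le>j. of_nat (j choose i) * F (Suc i) * t ^ i)"
    unfolding w_def using Suc.prems x y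
    by (subst Suc.IH)
       (auto intro!: sum.cong symmetric_formD[OF T(2)] simp: F_def subset_iff)
  \<comment> \<open>The added summand is zero since \<open>j choose Suc j = 0\<close>; it aligns the
    range with that of the shifted second sum.\<close>
  also have "(\<Sum>i\<le>j. of_nat (j choose i) * F i * t ^ i) =
      (\<Sum>i\<le>Suc j. of_nat (j choose i) * F i * t ^ i)"
    by (simp add: binomial_eq_0)
  also have "\<dots> + t * (\<Sum>i\<le>j. of_nat (j choose i) * F (Suc i) * t ^ i) =
      (\<Sum>i\<le>Suc j. of_nat (Suc j choose i) * F i * t ^ i)"
    by (simp add: sum.atMost_Suc_shift sum_distrib_left algebra_simps sum.distrib
        del: sum.atMost_Suc)
  finally show ?case
    by (simp add: w_def F_def)
qed simp

text \<open>Polarization: both forms agree at \<open>x + t \<cdot>\<^sub>v y\<close> in the repeated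
  slots for every \<open>t\<close>, hence so do the coefficients of \<open>t\<close>, which are
  multiples of the values with one \<open>x\<close> replaced by \<open>y\<close>. Induction on
  \<open>ys\<close> frees the arguments one by one.\<close>

lemma multilinear_form_eqI_diagonal:
  fixes T U :: "real vec list \<Rightarrow> real"
  assumes T: "multilinear_form n k T" "symmetric_form n k T"
    and U: "multilinear_form n k U" "symmetric_form n k U"
    and diag: "\<And>x. x \<in> carrier_vec n \<Longrightarrow> T (replicate k x) = U (replicate k x)"
  shows "T = U"
proof -
  have eq: "T (replicate j x @ ys) = U (replicate j x @ ys)"
    if "j + length ys = k" "set ys \<subseteq> carrier_vec n" "x \<in> carrier_vec n" for j x ys
    using that
  proof (induction ys arbitrary: j x)
    case Nil
    then show ?case using diag by simp
  next
    case (Cons y ys)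
    define a where "a i = real (Suc j choose i) *
      (T (replicate (Suc j - i) x @ replicate i y @ ys) -
       U (replicate (Suc j - i) x @ replicate i y @ ys))" for i
    have "(\<Sum>i\<le>Suc j. a i * t ^ i) = 0" for t
    proof -
      have "(\<Sum>i\<le>Suc j. a i * t ^ i) =
          T (replicate (Suc j) (x + t \<cdot>\<^sub>v y) @ ys) - U (replicate (Suc j) (x + t \<cdot>\<^sub>v y) @ ys)"
        using Cons.prems
        by (subst multilinear_form_binomial[OF T], simp, simp, simp, simp,
            subst multilinear_form_binomial[OF U], simp, simp, simp, simp)
           (simp only: a_def sum_subtractf[symmetric] algebra_simps)
      also have "\<dots> = 0"
        using Cons.IH[of "Suc j" "x + t \<cdot>\<^sub>v y"] Cons.prems by simp
      finally show ?thesis .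
    qed
    moreover have "{..Suc j} = insert 1 ({..Suc j} - {1})"
      by auto
    \<comment> \<open>Applied with \<open>M = 0\<close>, the coefficient bound says that a
      polynomial vanishing on the unit interval has zero linear coefficient.\<close>
    moreover obtain C where "\<And>b :: nat \<Rightarrow> real. \<And>M.
      (\<forall>t\<in>{0..1}. \<bar>\<Sum>i\<in>insert 1 ({..Suc j} - {1}). b i * t ^ i\<bar> \<le> M) \<Longrightarrow> \<bar>b 1\<bar> \<le> C * M"
      using coeff_bound[of "{..Suc j} - {1}" 1] by auto
    ultimately have "\<bar>a 1\<bar> \<le> C * 0"
      by (metis abs_zero order_refl)
    then show ?case
      by (simp add: a_def)
  qed
  have "T xs = U xs" if "xs \<in> vec_tuples n k" for xs
    using eq[of 0 xs "0\<^sub>v n"] that by (auto simp: vec_tuples_def)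
  then show ?thesis
    using T(1) U(1) unfolding multilinear_form_def by (auto intro: extensionalityI)
qed

section \<open>Explicit construction of the polar form\<close>

text \<open>Listing the variables with multiplicity makes the orderings of a monomial the
  permutations of a multiset, with one index for each argument of the form.\<close>

definition monomial_mset :: "(nat \<Rightarrow>\<^sub>0 nat) \<Rightarrow> nat multiset" where
  "monomial_mset m = (\<Sum>i\<in>Poly_Mapping.keys m. replicate_mset (Poly_Mapping.lookup m i) i)"

text \<open>
  A monomial with exponents \<open>m\<close> is polarized by averaging the products
  \<open>xs\<^sub>0(is\<^sub>0) \<cdots> xs\<^sub>k\<^sub>-\<^sub>1(is\<^sub>k\<^sub>-\<^sub>1)\<close> over all orderings \<open>is\<close> of its variables.
\<close>

definition sym_tensor :: "real_mpoly \<Rightarrow> 'a::real_field vec list \<Rightarrow> 'a" where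
  "sym_tensor p xs = (\<Sum>m\<in>Poly_Mapping.keys p.
     of_real (Poly_Mapping.lookup p m) / of_nat (card (permutations_of_multiset (monomial_mset m))) *
     (\<Sum>is\<in>permutations_of_multiset (monomial_mset m). \<Prod>j<length xs. (xs ! j) $ (is ! j)))"

lemma monomial_mset_form:
  assumes "is_form n k p" "m \<in> Poly_Mapping.keys p"
  shows "size (monomial_mset m) = k" "set_mset (monomial_mset m) \<subseteq> {..<n}"
proof -
  show "size (monomial_mset m) = k"
    using assms by (simp add: is_form_def monomial_mset_def size_multiset_sum)
  have "Poly_Mapping.keys m \<subseteq> {..<n}"
    using assms by (simp add: is_form_def)
  then show "set_mset (monomial_mset m) \<subseteq> {..<n}"
    by (auto simp: monomial_mset_def set_mset_sum split: if_splits)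
qed

lemma index_monomial_permutation:
  assumes "is_form n k p" "m \<in> Poly_Mapping.keys p"
    and "is \<in> permutations_of_multiset (monomial_mset m)"
  shows "length is = k" "j < k \<Longrightarrow> is ! j < n"
proof -
  have "mset is = monomial_mset m"
    using assms(3) by (rule permutations_of_multisetD)
  then have "size (mset is) = k" "set is \<subseteq> {..<n}"
    using monomial_mset_form[OF assms(1,2)] by (metis set_mset_mset)+
  then show "length is = k" "j < k \<Longrightarrow> is ! j < n"
    by (auto dest: nth_mem)
qed

text \<open>Isolates the only factor that depends on slot \<open>i\<close>. It is a single
  coordinate of \<open>u\<close>, which is why each product is linear in that slot.\<close>

lemma prod_index_list_update:
  assumes "i < length xs"
  shows "(\<Prod>j<length xs. (xs[i := u] ! j) $ (is ! j)) =
    (u $ (is ! i)) * (\<Prod>j\<in>{..<length xs} - {i}. ((xs ! j) $ (is ! j) :: 'a::comm_monoid_mult))"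
  using assms by (subst prod.remove[of _ i]) (auto intro!: prod.cong)

lemma sym_tensor_update_add:
  assumes p: "is_form n k p" and "length xs = k" "i < k"
    and "u \<in> carrier_vec n" "v \<in> carrier_vec n"
  shows "sym_tensor p (xs[i := u + v]) = sym_tensor p (xs[i := u]) + sym_tensor p (xs[i := v])"
proof -
  have "(\<Prod>j<k. (xs[i := u + v] ! j) $ (is ! j)) =
      (\<Prod>j<k. (xs[i := u] ! j) $ (is ! j)) + (\<Prod>j<k. (xs[i := v] ! j) $ (is ! j))"
    if "m \<in> Poly_Mapping.keys p" "is \<in> permutations_of_multiset (monomial_mset m)" for m "is"
    using prod_index_list_update[of i xs _ "is"] assms index_monomial_permutation(2)[OF p that, of i]
    by (simp add: distrib_right)
  then show ?thesis
    using assms(2) by (simp add: sym_tensor_def sum.distrib ring_distribs cong: sum.cong)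
qed

lemma sym_tensor_update_smult:
  assumes p: "is_form n k p" and "length xs = k" "i < k" "v \<in> carrier_vec n"
  shows "sym_tensor p (xs[i := c \<cdot>\<^sub>v v]) = c * sym_tensor p (xs[i := v])"
proof -
  have "(\<Prod>j<k. (xs[i := c \<cdot>\<^sub>v v] ! j) $ (is ! j)) = c * (\<Prod>j<k. (xs[i := v] ! j) $ (is ! j))"
    if "m \<in> Poly_Mapping.keys p" "is \<in> permutations_of_multiset (monomial_mset m)" for m "is"
    using prod_index_list_update[of i xs _ "is"] assms index_monomial_permutation(2)[OF p that, of i]
    by simp
  then show ?thesis
    using assms(2)
    by (simp add: sym_tensor_def sum_distrib_left mult.left_commute cong: sum.cong)
qed

text \<open>Permuting the arguments is undone by permuting every ordering in the same way, and this
  only reindexes the sum over all orderings.\<close>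

lemma sym_tensor_mset_cong:
  assumes "is_form n k p" "length ys = k" "mset xs = mset ys"
  shows "sym_tensor p xs = sym_tensor p ys"
proof -
  obtain \<pi> where \<pi>: "\<pi> permutes {..<length ys}" "permute_list \<pi> ys = xs"
    using mset_eq_permutation[OF assms(3)] by metis
  define \<rho> where "\<rho> = inv_into UNIV \<pi>"
  have \<pi>': "\<rho> permutes {..<k}"
    using permutes_inv[OF \<pi>(1)] assms(2) by (simp add: \<rho>_def)
  have inverse: "\<pi> \<circ> \<rho> = id" "\<rho> \<circ> \<pi> = id"
    using permutes_inv_o[OF \<pi>(1)] by (simp_all add: \<rho>_def)
  have len: "length xs = k"
    using mset_eq_length[OF assms(3)] assms(2) by simp
  have "(\<Sum>is\<in>permutations_of_multiset (monomial_mset m). \<Prod>j<k. (xs ! j) $ (is ! j)) =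
      (\<Sum>is\<in>permutations_of_multiset (monomial_mset m). \<Prod>j<k. (ys ! j) $ (is ! j))"
    (is "sum ?f ?A = sum ?g ?A") if m: "m \<in> Poly_Mapping.keys p" for m
  proof (rule sum.reindex_bij_witness[where i = "permute_list \<pi>" and j = "permute_list \<rho>"])
    fix "is"
    assume A: "is \<in> permutations_of_multiset (monomial_mset m)"
    then have k: "length is = k"
      using index_monomial_permutation(1)[OF assms(1) m] by blast
    have ps: "\<pi> permutes {..<length is}" "\<rho> permutes {..<length is}"
      using \<pi>(1) \<pi>' k assms(2) by simp_all
    show "permute_list \<rho> is \<in> ?A" "permute_list \<pi> is \<in> ?A"
      using ps A by (simp_all add: permutations_of_multiset_def)
    show "permute_list \<pi> (permute_list \<rho> is) = is"
      using permute_list_compose[OF ps(1), of "\<rho>"] inverse by simp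
    show "permute_list \<rho> (permute_list \<pi> is) = is"
      using permute_list_compose[OF ps(2), of \<pi>] inverse by simp
    have "?g (permute_list \<rho> is) = (\<Prod>j<k. (ys ! j) $ (is ! \<rho> j))"
      using ps k by (intro prod.cong) (simp_all add: permute_list_nth)
    also have "\<dots> = (\<Prod>j<k. (ys ! \<pi> j) $ (is ! \<rho> (\<pi> j)))"
      using \<pi>(1) assms(2) by (subst prod.permute[where p = \<pi>]) (auto simp: o_def)
    also have "\<dots> = ?f is"
      using \<pi> assms(2) pointfree_idE[OF inverse(2)]
      by (intro prod.cong) (auto simp: permute_list_nth[symmetric])
    finally show "?g (permute_list \<rho> is) = ?f is" .
  qed
  then show ?thesis
    using assms(2) len by (simp add: sym_tensor_def cong: sum.cong)
qed

text \<open>With equal arguments every ordering contributes the same product, the value of the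
  monomial, so the average is that value.\<close>

lemma sym_tensor_diagonal:
  assumes p: "is_form n k p"
  shows "sym_tensor p (replicate k x) = poly_eval p x"
  unfolding sym_tensor_def poly_eval_def
proof (rule sum.cong)
  fix m
  assume m: "m \<in> Poly_Mapping.keys p"
  let ?A = "permutations_of_multiset (monomial_mset m)"
  have "(\<Prod>j<k. (replicate k x ! j) $ (is ! j)) =
      (\<Prod>i\<in>Poly_Mapping.keys m. (x $ i) ^ Poly_Mapping.lookup m i)" if "is \<in> ?A" for "is"
  proof -
    have "mset is = monomial_mset m"
      using that by (rule permutations_of_multisetD)
    have "(\<Prod>j<k. (replicate k x ! j) $ (is ! j)) = (\<Prod>j<length is. x $ (is ! j))"
      using index_monomial_permutation(1)[OF p m that] by (intro prod.cong) auto
    also have "\<dots> = prod_list (map (($) x) is)"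
      by (simp add: prod.list_conv_set_nth atLeast0LessThan)
    also have "\<dots> = prod_mset (image_mset (($) x) (mset is))"
      by (simp flip: prod_mset_prod_list)
    also have "\<dots> = (\<Prod>i\<in>Poly_Mapping.keys m. prod_mset (image_mset (($) x) (replicate_mset (Poly_Mapping.lookup m i) i)))"
      unfolding \<open>mset is = monomial_mset m\<close> monomial_mset_def
      by (induction rule: finite_induct[OF finite_keys[of m]]) auto
    finally show ?thesis by simp
  qed
  moreover have "card ?A \<noteq> 0"
    by simp
  ultimately show "of_real (Poly_Mapping.lookup p m) / of_nat (card ?A) *
      (\<Sum>is\<in>?A. \<Prod>j<length (replicate k x). (replicate k x ! j) $ (is ! j)) =
      of_real (Poly_Mapping.lookup p m) * (\<Prod>i\<in>Poly_Mapping.keys m. (x $ i) ^ Poly_Mapping.lookup m i)"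
    by simp
qed simp

lemma sym_tensor_of_real:
  assumes p: "is_form n k p" and "xs \<in> vec_tuples n k"
  shows "sym_tensor p (map (map_vec complex_of_real) xs) = complex_of_real (sym_tensor p xs)"
proof -
  have "(\<Prod>j<k. (map (map_vec complex_of_real) xs ! j) $ (is ! j)) =
      complex_of_real (\<Prod>j<k. (xs ! j) $ (is ! j))"
    if m: "m \<in> Poly_Mapping.keys p" and perm: "is \<in> permutations_of_multiset (monomial_mset m)"
    for m "is"
  proof -
    have "(map (map_vec complex_of_real) xs ! j) $ (is ! j) = complex_of_real ((xs ! j) $ (is ! j))"
      if j: "j < k" for j
    proof -
      have "j < length xs" "xs ! j \<in> carrier_vec n"
        using assms(2) nth_mem[of j xs] j by (auto simp: vec_tuples_def)
      \<comment> \<open>An entry of \<open>map_vec\<close> can be computed only at an index below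
        the dimension.\<close>
      moreover have "is ! j < n"
        using index_monomial_permutation(2)[OF p m perm j] .
      ultimately show ?thesis by simp
    qed
    then show ?thesis
      by (simp only: of_real_prod) (intro prod.cong refl, simp)
  qed
  then show ?thesis
    using assms(2) by (simp add: sym_tensor_def vec_tuples_def cong: sum.cong)
qed

text \<open>The restriction supplies the extensionality that \<open>multilinear_form\<close>
  demands. The scalar type is left open so that one formula serves as real polar form and as its
  complex extension.\<close>

definition sym_form :: "nat \<Rightarrow> nat \<Rightarrow> real_mpoly \<Rightarrow> 'a::real_field vec list \<Rightarrow> 'a" where
  "sym_form n k p = restrict (sym_tensor p) (vec_tuples n k)"

lemma sym_form_eq:
  "length xs = k \<Longrightarrow> set xs \<subseteq> carrier_vec n \<Longrightarrow> sym_form n k p xs = sym_tensor p xs"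
  by (simp add: sym_form_def vec_tuples_def)

lemma vec_tuples_update:
  "xs \<in> vec_tuples n k \<Longrightarrow> v \<in> carrier_vec n \<Longrightarrow> xs[i := v] \<in> vec_tuples n k"
  unfolding vec_tuples_def using set_update_subset_insert[of xs i v] by auto

lemma multilinear_sym_form:
  assumes "is_form n k p"
  shows "multilinear_form n k (sym_form n k p)"
  unfolding multilinear_form_def
proof (intro conjI ballI allI impI)
  show "sym_form n k p \<in> extensional (vec_tuples n k)"
    by (simp add: sym_form_def)
next
  fix xs :: "'a vec list" and i and u v :: "'a vec"
  assume *: "xs \<in> vec_tuples n k" "i < k" "u \<in> carrier_vec n" "v \<in> carrier_vec n"
  then have "length xs = k"
    by (simp add: vec_tuples_def)
  with * show "sym_form n k p (xs[i := u + v]) = sym_form n k p (xs[i := u]) + sym_form n k p (xs[i := v])"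
    by (simp add: sym_form_def vec_tuples_update sym_tensor_update_add[OF assms])
next
  fix xs :: "'a vec list" and i and v :: "'a vec" and c
  assume *: "xs \<in> vec_tuples n k" "i < k" "v \<in> carrier_vec n"
  then have "length xs = k"
    by (simp add: vec_tuples_def)
  with * show "sym_form n k p (xs[i := c \<cdot>\<^sub>v v]) = c * sym_form n k p (xs[i := v])"
    by (simp add: sym_form_def vec_tuples_update sym_tensor_update_smult[OF assms])
qed

lemma symmetric_sym_form:
  assumes "is_form n k p"
  shows "symmetric_form n k (sym_form n k p)"
  unfolding symmetric_form_def
proof (intro ballI impI)
  fix xs ys :: "'a vec list"
  assume *: "xs \<in> vec_tuples n k" "ys \<in> vec_tuples n k" "mset xs = mset ys"
  then have "length ys = k"
    by (simp add: vec_tuples_def)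
  from sym_tensor_mset_cong[OF assms this *(3)] * show "sym_form n k p xs = sym_form n k p ys"
    by (simp add: sym_form_def)
qed

lemma sym_form_diagonal:
  "is_form n k p \<Longrightarrow> x \<in> carrier_vec n \<Longrightarrow> sym_form n k p (replicate k x) = poly_eval p x"
  by (subst sym_form_eq) (auto simp: sym_tensor_diagonal)

section \<open>Uniqueness of the polar form and of its complex extension\<close>

text \<open>Resolves the definite description: \<open>sym_form\<close> is a witness, and a symmetric
  multilinear form is determined by its diagonal.\<close>

lemma polar_form_eq:
  assumes "is_form n k p"
  shows "polar_form n k p = sym_form n k p"
  unfolding polar_form_def
proof (rule the_equality)
  show "multilinear_form n k (sym_form n k p) \<and> symmetric_form n k (sym_form n k p) \<and>
      (\<forall>x\<in>carrier_vec n. poly_eval p x = sym_form n k p (replicate k (x :: real vec)))"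
    using assms by (simp add: multilinear_sym_form symmetric_sym_form sym_form_diagonal)
next
  fix T :: "real vec list \<Rightarrow> real"
  assume "multilinear_form n k T \<and> symmetric_form n k T \<and>
    (\<forall>x\<in>carrier_vec n. poly_eval p x = T (replicate k x))"
  then show "T = sym_form n k p"
    using assms
    by (intro multilinear_form_eqI_diagonal[of n k])
       (simp_all add: multilinear_sym_form symmetric_sym_form sym_form_diagonal)
qed

text \<open>Each complex argument splits into real and imaginary part. The induction takes the last
  entry of \<open>zs\<close> and moves its two parts to the front of the real arguments
  \<open>xs\<close>.\<close>

lemma multilinear_form_eqI_real:
  fixes S U :: "complex vec list \<Rightarrow> complex"
  assumes S: "multilinear_form n k S" and U: "multilinear_form n k U"
    and real: "\<And>xs. xs \<in> vec_tuples n k \<Longrightarrow>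
      S (map (map_vec complex_of_real) xs) = U (map (map_vec complex_of_real) xs)"
  shows "S = U"
proof -
  have eq: "S (zs @ map (map_vec complex_of_real) xs) = U (zs @ map (map_vec complex_of_real) xs)"
    if "length zs + length xs = k" "set zs \<subseteq> carrier_vec n" "set xs \<subseteq> carrier_vec n" for zs xs
    using that
  proof (induction zs arbitrary: xs rule: rev_induct)
    case Nil
    then show ?case using real by (simp add: vec_tuples_def)
  next
    case (snoc z zs)
    let ?re = "map_vec Re z" and ?im = "map_vec Im z"
    let ?c = "map_vec complex_of_real"
    have z: "z \<in> carrier_vec n"
      using snoc.prems by simp
    have z_eq: "z = ?c ?re + \<i> \<cdot>\<^sub>v ?c ?im"
      by (intro eq_vecI) (simp_all add: complex_eq_iff)
    have split: "V (zs @ z # map ?c xs) = V (zs @ map ?c (?re # xs)) + \<i> * V (zs @ map ?c (?im # xs))"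
      if V: "multilinear_form n k V" for V
    proof -
      have prems: "Suc (length zs + length (map ?c xs)) = k" "set zs \<subseteq> carrier_vec n"
        "set (map ?c xs) \<subseteq> carrier_vec n"
        using snoc.prems by auto
      have "V (zs @ z # map ?c xs) = V (zs @ (?c ?re + \<i> \<cdot>\<^sub>v ?c ?im) # map ?c xs)"
        using z_eq by simp
      also have "\<dots> = V (zs @ ?c ?re # map ?c xs) + \<i> * V (zs @ ?c ?im # map ?c xs)"
        using z by (subst multilinear_form_add[OF V prems])
          (auto simp: multilinear_form_smult[OF V prems])
      finally show ?thesis by simp
    qed
    show ?case
      using split[OF S] split[OF U] snoc.IH[of "?re # xs"] snoc.IH[of "?im # xs"] snoc.prems
      by simp
  qed
  have "S zs = U zs" if "zs \<in> vec_tuples n k" for zs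
    using eq[of zs "[]"] that by (simp add: vec_tuples_def)
  then show ?thesis
    using S U unfolding multilinear_form_def by (auto intro: extensionalityI)
qed

text \<open>The coefficients of the form are real, so the complex instance of the formula restricts
  to the real one on real vectors. The two occurrences of \<open>sym_form\<close> have different
  types.\<close>

lemma complex_extension_sym_form:
  assumes "is_form n k p"
  shows "complex_extension n k (sym_form n k p) = sym_form n k p"
  unfolding complex_extension_def
proof (rule the_equality)
  have real: "sym_form n k p (map (map_vec complex_of_real) xs) = complex_of_real (sym_form n k p xs)"
    if "xs \<in> vec_tuples n k" for xs
  proof -
    have "map (map_vec complex_of_real) xs \<in> vec_tuples n k"
      using that by (auto simp: vec_tuples_def)
    then show ?thesis
      using sym_tensor_of_real[OF assms that] that by (simp add: sym_form_def)
  qed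
  then show "multilinear_form n k (sym_form n k p) \<and> (\<forall>xs\<in>vec_tuples n k.
      sym_form n k p (map (map_vec complex_of_real) xs) = complex_of_real (sym_form n k p xs))"
    using multilinear_sym_form[OF assms] by blast
  fix S
  assume "multilinear_form n k S \<and> (\<forall>xs\<in>vec_tuples n k.
    S (map (map_vec complex_of_real) xs) = complex_of_real (sym_form n k p xs))"
  then show "S = sym_form n k p"
    using real multilinear_sym_form[OF assms]
    by (intro multilinear_form_eqI_real[of n k]) simp_all
qed

section \<open>Derivatives of forms and consequences of convexity\<close>

text \<open>Recentred at \<open>x + s \<cdot>\<^sub>v v\<close>, the function is a polynomial in the
  increment \<open>h\<close>, and the derivative is its linear coefficient. The fixed tail
  \<open>ys\<close> allows a second differentiation.\<close>

lemma has_derivative_multilinear_form: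
  fixes T :: "real vec list \<Rightarrow> real"
  assumes T: "multilinear_form n k T" "symmetric_form n k T"
    and ys: "j + length ys = k" "set ys \<subseteq> carrier_vec n"
    and x: "x \<in> carrier_vec n" and v: "v \<in> carrier_vec n"
  shows "((\<lambda>t. T (replicate j (x + t \<cdot>\<^sub>v v) @ ys)) has_real_derivative
    real j * T (replicate (j - 1) (x + s \<cdot>\<^sub>v v) @ v # ys)) (at s)"
proof -
  define x' where "x' = x + s \<cdot>\<^sub>v v"
  have x': "x' \<in> carrier_vec n"
    using x v by (simp add: x'_def)
  define c where "c i = real (j choose i) * T (replicate (j - i) x' @ replicate i v @ ys)" for i
  have "x + (h + s) \<cdot>\<^sub>v v = x' + h \<cdot>\<^sub>v v" for h
    using x v by (intro eq_vecI) (auto simp: x'_def algebra_simps)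
  then have shift: "T (replicate j (x + (h + s) \<cdot>\<^sub>v v) @ ys) = (\<Sum>i\<le>j. c i * h ^ i)" for h
    using multilinear_form_binomial[OF T ys x' v, of h] by (simp add: c_def)
  have "((\<lambda>h. \<Sum>i\<le>j. c i * h ^ i) has_real_derivative (\<Sum>i\<le>j. c i * (real i * 0 ^ (i - 1)))) (at 0)"
    by (auto intro!: derivative_eq_intros sum.cong)
  also have "(\<Sum>i\<le>j. c i * (real i * 0 ^ (i - 1))) = real j * T (replicate (j - 1) x' @ v # ys)"
  proof (cases j)
    case (Suc j')
    \<comment> \<open>For \<open>i = 0\<close> the factor \<open>real i\<close> vanishes, and for
      \<open>i > 1\<close> the power of 0 does.\<close>
    have "(\<Sum>i\<le>j. c i * (real i * 0 ^ (i - 1))) = (\<Sum>i\<in>{1}. c i * (real i * 0 ^ (i - 1)))"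
      using Suc by (intro sum.mono_neutral_right) (auto simp: power_0_left)
    then show ?thesis
      by (simp add: c_def)
  qed simp
  finally show ?thesis
    using DERIV_shift[of "\<lambda>t. T (replicate j (x + t \<cdot>\<^sub>v v) @ ys)" _ 0 s]
    by (simp add: shift x'_def)
qed

lemma vec_add_zero_smult:
  fixes x v :: "real vec"
  shows "x \<in> carrier_vec n \<Longrightarrow> v \<in> carrier_vec n \<Longrightarrow> x + 0 \<cdot>\<^sub>v v = x"
  by (intro eq_vecI) auto

lemma partial_deriv_form:
  assumes p: "is_form n k p" and x: "x \<in> carrier_vec n"
  shows "partial_deriv n i (poly_eval p) x = real k * sym_form n k p (replicate (k - 1) x @ [unit_vec n i])"
proof -
  have "((\<lambda>t. sym_form n k p (replicate k (x + t \<cdot>\<^sub>v unit_vec n i) @ [])) has_real_derivative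
      real k * sym_form n k p (replicate (k - 1) (x + 0 \<cdot>\<^sub>v unit_vec n i) @ [unit_vec n i])) (at 0)"
    using x by (intro has_derivative_multilinear_form[OF multilinear_sym_form[OF p] symmetric_sym_form[OF p]]) auto
  then have "((\<lambda>t. poly_eval p (x + t \<cdot>\<^sub>v unit_vec n i)) has_real_derivative
      real k * sym_form n k p (replicate (k - 1) x @ [unit_vec n i])) (at 0)"
    using x by (simp add: sym_form_diagonal[OF p] vec_add_zero_smult)
  then show ?thesis
    unfolding partial_deriv_def by (rule DERIV_imp_deriv)
qed

lemma hessian_form:
  assumes p: "is_form n k p" and x: "x \<in> carrier_vec n" and "2 \<le> k" "i < n" "j < n"
  shows "hessian n (poly_eval p) x $$ (i, j) =
    real k * real (k - 1) * sym_form n k p (replicate (k - 2) x @ [unit_vec n i, unit_vec n j])"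
proof -
  have "((\<lambda>t. sym_form n k p (replicate (k - 1) (x + t \<cdot>\<^sub>v unit_vec n i) @ [unit_vec n j])) has_real_derivative
      real (k - 1) * sym_form n k p (replicate (k - 1 - 1) (x + 0 \<cdot>\<^sub>v unit_vec n i) @ [unit_vec n i, unit_vec n j])) (at 0)"
    using x \<open>2 \<le> k\<close>
    by (intro has_derivative_multilinear_form[OF multilinear_sym_form[OF p] symmetric_sym_form[OF p]]) auto
  from DERIV_cmult[OF this, of "real k"]
  have "((\<lambda>t. partial_deriv n j (poly_eval p) (x + t \<cdot>\<^sub>v unit_vec n i)) has_real_derivative
      real k * (real (k - 1) * sym_form n k p (replicate (k - 2) x @ [unit_vec n i, unit_vec n j]))) (at 0)"
    using x by (simp add: partial_deriv_form[OF p] vec_add_zero_smult numeral_2_eq_2)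
  from DERIV_imp_deriv[OF this] show ?thesis
    using assms by (simp add: hessian_def partial_deriv_def[of n i])
qed

text \<open>Expanding the last two arguments in unit vectors shows that the quadratic form of the
  Hessian at \<open>v\<close> is \<open>k * (k - 1)\<close> times this value, and the factor is
  positive.\<close>

lemma convex_form_second_derivative_nonneg:
  fixes x :: "real vec"
  assumes p: "convex_form n k p" and "2 \<le> k" and x: "x \<in> carrier_vec n" and v: "v \<in> carrier_vec n"
  shows "0 \<le> sym_form n k p (replicate (k - 2) x @ [v, v])"
proof -
  have form: "is_form n k p"
    using p by (simp add: convex_form_def)
  let ?F = "sym_form n k p" and ?H = "hessian n (poly_eval p) x"
  have H: "?H \<in> carrier_mat n n"
    by (simp add: hessian_def)
  have inner: "?F (replicate (k - 2) x @ [unit_vec n i, v]) =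
      (\<Sum>j<n. v $ j * ?F (replicate (k - 2) x @ [unit_vec n i, unit_vec n j]))" for i
  proof -
    have "Suc (length (replicate (k - 2) x @ [unit_vec n i]) + length []) = k"
      using \<open>2 \<le> k\<close> by simp
    from multilinear_form_expand[OF multilinear_sym_form[OF form] this _ _ v] show ?thesis
      using x by (simp add: subset_iff)
  qed
  have "?F (replicate (k - 2) x @ [v, v]) = (\<Sum>i<n. v $ i * ?F (replicate (k - 2) x @ [unit_vec n i, v]))"
    using x v \<open>2 \<le> k\<close> by (intro multilinear_form_expand[OF multilinear_sym_form[OF form]]) auto
  note F = this[unfolded inner]
  have "0 \<le> v \<bullet> (?H *\<^sub>v v)"
    using p x v by (simp add: convex_form_def psd_mat_def)
  also have "\<dots> = (\<Sum>i<n. v $ i * (\<Sum>j<n. ?H $$ (i, j) * v $ j))"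
    using H v by (simp add: scalar_prod_def atLeast0LessThan)
  also have "\<dots> = real k * real (k - 1) * ?F (replicate (k - 2) x @ [v, v])"
    unfolding F using hessian_form[OF form x \<open>2 \<le> k\<close>]
    by (simp add: sum_distrib_left mult_ac)
  finally have "0 \<le> real k * real (k - 1) * ?F (replicate (k - 2) x @ [v, v])" .
  moreover have "0 < real k * real (k - 1)"
    using \<open>2 \<le> k\<close> by simp
  ultimately show ?thesis
    by (meson zero_le_mult_iff not_less)
qed

lemma convex_form_nonneg:
  fixes x :: "real vec"
  assumes "convex_form n k p" "2 \<le> k" "x \<in> carrier_vec n"
  shows "0 \<le> poly_eval p x"
proof -
  have "replicate (k - 2) x @ [x, x] = replicate k x"
    using le_Suc_ex[OF \<open>2 \<le> k\<close>] by (auto simp: numeral_2_eq_2 replicate_app_Cons_same)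
  then show ?thesis
    using convex_form_second_derivative_nonneg[OF assms assms(3)] assms
    by (simp add: convex_form_def sym_form_diagonal)
qed

lemma poly_eval_smult:
  assumes p: "is_form n k p" and x: "x \<in> carrier_vec n"
  shows "poly_eval p (c \<cdot>\<^sub>v x) = c ^ k * (poly_eval p x :: 'a::real_field)"
  using multilinear_form_replicate_smult[OF multilinear_sym_form[OF p], of "[]" k "[]" x c] x
  by (simp add: sym_form_diagonal[OF p])

text \<open>Convexity on the segment from \<open>x\<close> to \<open>y\<close> bounds the value at
  the midpoint by the mean of the end values. Since \<open>x + y\<close> is twice the midpoint,
  homogeneity contributes \<open>2 ^ k\<close>, and the mean takes away one factor 2.\<close>

lemma convex_form_add_le:
  fixes x :: "real vec"
  assumes p: "convex_form n k p" and "2 \<le> k" and x: "x \<in> carrier_vec n" and y: "y \<in> carrier_vec n"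
  shows "poly_eval p (x + y) \<le> 2 ^ (k - 1) * (poly_eval p x + poly_eval p y)"
proof -
  have form: "is_form n k p"
    using p by (simp add: convex_form_def)
  note T = multilinear_sym_form[OF form] symmetric_sym_form[OF form]
  let ?F = "sym_form n k p"
  define v where "v = y - x"
  have v: "v \<in> carrier_vec n"
    using x y by (simp add: v_def)
  define f where "f t = poly_eval p (x + t \<cdot>\<^sub>v v)" for t
  have f_eq: "f = (\<lambda>t. ?F (replicate k (x + t \<cdot>\<^sub>v v) @ []))"
    using x v by (simp add: f_def sym_form_diagonal[OF form] fun_eq_iff)
  have "convex_on UNIV f"
  proof (rule f''_ge0_imp_convex)
    show "(f has_real_derivative real k * ?F (replicate (k - 1) (x + t \<cdot>\<^sub>v v) @ [v])) (at t)" for t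
      unfolding f_eq using x v by (intro has_derivative_multilinear_form[OF T]) auto
    show "((\<lambda>t. real k * ?F (replicate (k - 1) (x + t \<cdot>\<^sub>v v) @ [v])) has_real_derivative
        real k * (real (k - 1) * ?F (replicate (k - 1 - 1) (x + t \<cdot>\<^sub>v v) @ [v, v]))) (at t)" for t
      using x v \<open>2 \<le> k\<close> by (intro DERIV_cmult has_derivative_multilinear_form[OF T]) auto
    show "0 \<le> real k * (real (k - 1) * ?F (replicate (k - 1 - 1) (x + t \<cdot>\<^sub>v v) @ [v, v]))" for t
      using convex_form_second_derivative_nonneg[OF p \<open>2 \<le> k\<close> _ v, of "x + t \<cdot>\<^sub>v v"] x v
      by (simp add: numeral_2_eq_2)
  qed simp
  from convex_onD[OF this, of "1/2" 0 1] have mid: "f (1/2) \<le> (f 0 + f 1) / 2"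
    by simp
  have "x + y = 2 \<cdot>\<^sub>v (x + (1/2) \<cdot>\<^sub>v v)"
    using x y by (intro eq_vecI) (auto simp: v_def field_simps)
  then have "poly_eval p (x + y) = 2 ^ k * f (1/2)"
    using x v by (simp add: f_def poly_eval_smult[OF form])
  moreover have "f 0 = poly_eval p x"
    using x v by (simp add: f_def vec_add_zero_smult)
  moreover have "x + 1 \<cdot>\<^sub>v v = y"
    using x y by (intro eq_vecI) (auto simp: v_def)
  then have "f 1 = poly_eval p y"
    by (simp add: f_def)
  moreover have "(2 :: real) ^ k = 2 * 2 ^ (k - 1)"
    using \<open>2 \<le> k\<close> by (cases k) auto
  ultimately show ?thesis
    using mult_left_mono[OF mid, of "2 ^ k"] by (simp add: algebra_simps)
qed

section \<open>The first inequality: from a sum to a geometric mean\<close>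

lemma le_sqrt_mult_of_scaling:
  fixes a b q K :: real
  assumes nonneg: "0 \<le> a" "0 \<le> b" "0 \<le> K" and le: "\<And>\<mu>. \<mu> > 0 \<Longrightarrow> q \<le> K * (\<mu> * a + b / \<mu>)"
  shows "q \<le> 2 * K * sqrt (a * b)"
proof -
  have "q \<le> 2 * K * sqrt ((a + \<epsilon>) * (b + \<epsilon>))" if "\<epsilon> > 0" for \<epsilon>
  proof -
    \<comment> \<open>With \<open>\<mu> = s / r\<close> both perturbed terms equal
      \<open>r * s\<close>, whence the factor 2.\<close>
    define r s where "r = sqrt (a + \<epsilon>)" and "s = sqrt (b + \<epsilon>)"
    have pos: "r > 0" "s > 0" and sq: "r * r = a + \<epsilon>" "s * s = b + \<epsilon>"
      using nonneg that by (auto simp: r_def s_def)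
    have "a \<le> r * r" "b \<le> s * s"
      using sq that by linarith+
    then have "s / r * a \<le> s / r * (r * r)" "r / s * b \<le> r / s * (s * s)"
      using pos by (intro mult_left_mono; simp)+
    moreover have "s / r * (r * r) = r * s" "r / s * (s * s) = r * s" "b / (s / r) = r / s * b"
      using pos by simp_all
    ultimately have "s / r * a + b / (s / r) \<le> 2 * (r * s)"
      by linarith
    from mult_left_mono[OF this \<open>0 \<le> K\<close>] le[of "s / r"] pos show ?thesis
      by (simp add: r_def s_def real_sqrt_mult)
  qed
  then have "\<forall>\<^sub>F \<epsilon> in at_right 0. q \<le> 2 * K * sqrt ((a + \<epsilon>) * (b + \<epsilon>))"
    using eventually_at_right_less by (rule eventually_mono[rotated])
  moreover have "((\<lambda>\<epsilon>. 2 * K * sqrt ((a + \<epsilon>) * (b + \<epsilon>))) \<longlongrightarrow> 2 * K * sqrt ((a + 0) * (b + 0))) (at_right 0)"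
    by (intro tendsto_intros)
  ultimately have "q \<le> 2 * K * sqrt ((a + 0) * (b + 0))"
    by (intro tendsto_lowerbound[OF _ _ trivial_limit_at_right_real])
  then show ?thesis
    by simp
qed

lemma biform_eq:
  "is_form n (2 * d) p \<Longrightarrow> biform n d p x y = sym_form n (2 * d) p (replicate d x @ replicate d y)"
  by (simp add: biform_def polar_form_eq)

text \<open>Both arguments occur \<open>d\<close> times, so the factors \<open>c ^ d\<close> and
  \<open>inverse c ^ d\<close> cancel.\<close>

lemma biform_scale:
  assumes p: "is_form n (2 * d) p" and x: "x \<in> carrier_vec n" and y: "y \<in> carrier_vec n"
    and "c \<noteq> 0"
  shows "biform n d p (c \<cdot>\<^sub>v x) (inverse c \<cdot>\<^sub>v y) = biform n d p x y"
  using multilinear_form_replicate_smult[OF multilinear_sym_form[OF p],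
      of "[]" d "replicate d (inverse c \<cdot>\<^sub>v y)" x c]
    multilinear_form_replicate_smult[OF multilinear_sym_form[OF p],
      of "replicate d x" d "[]" y "inverse c"] x y \<open>c \<noteq> 0\<close>
  by (auto simp: biform_eq[OF p] subset_iff power_inverse)

lemma biform_le:
  assumes "d > 0"
  shows "\<exists>K\<ge>0. \<forall>n p. convex_form n (2 * d) p \<longrightarrow> (\<forall>x\<in>carrier_vec n. \<forall>y\<in>carrier_vec n.
    biform n d p x y \<le> K * (poly_eval p x + poly_eval p y))"
proof -
  let ?J = "{..2 * d} - {d}"
  have insert_J: "insert d ?J = {..2 * d}"
    by auto
  \<comment> \<open>\<open>C\<close> is fixed before \<open>n\<close>, \<open>p\<close>,
    \<open>x\<close> and \<open>y\<close>, so it depends on \<open>d\<close> alone.\<close>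
  obtain C where C: "C \<ge> 0" "\<And>a :: nat \<Rightarrow> real. \<And>M.
    \<forall>t\<in>{0..1}. \<bar>\<Sum>i\<le>2 * d. a i * t ^ i\<bar> \<le> M \<Longrightarrow> \<bar>a d\<bar> \<le> C * M"
    using coeff_bound[of ?J d, unfolded insert_J] by blast
  have "biform n d p x y \<le> C * 2 ^ (2 * d - 1) * (poly_eval p x + poly_eval p y)"
    if p: "convex_form n (2 * d) p" and x: "x \<in> carrier_vec n" and y: "y \<in> carrier_vec n" for n p x y
  proof -
    have form: "is_form n (2 * d) p"
      using p by (simp add: convex_form_def)
    have d: "2 \<le> 2 * d"
      using \<open>d > 0\<close> by simp
    define a where "a i = real (2 * d choose i) *
      sym_form n (2 * d) p (replicate (2 * d - i) x @ replicate i y @ [])" for i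
    have "\<bar>\<Sum>i\<le>2 * d. a i * t ^ i\<bar> \<le> 2 ^ (2 * d - 1) * (poly_eval p x + poly_eval p y)"
      if t: "t \<in> {0..1}" for t
    proof -
      have ty: "t \<cdot>\<^sub>v y \<in> carrier_vec n"
        using y by simp
      have "(\<Sum>i\<le>2 * d. a i * t ^ i) = poly_eval p (x + t \<cdot>\<^sub>v y)"
        using multilinear_form_binomial[OF multilinear_sym_form[OF form] symmetric_sym_form[OF form],
            of "2 * d" "[]" x y t] x y
        by (simp add: a_def sym_form_diagonal[OF form])
      moreover have "poly_eval p (x + t \<cdot>\<^sub>v y) \<le> 2 ^ (2 * d - 1) * (poly_eval p x + t ^ (2 * d) * poly_eval p y)"
        using convex_form_add_le[OF p d x ty] by (simp add: poly_eval_smult[OF form y])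
      moreover have "t ^ (2 * d) * poly_eval p y \<le> 1 * poly_eval p y"
        using t convex_form_nonneg[OF p d y] by (intro mult_right_mono power_le_one) auto
      then have "2 ^ (2 * d - 1) * (poly_eval p x + t ^ (2 * d) * poly_eval p y) \<le>
          2 ^ (2 * d - 1) * (poly_eval p x + poly_eval p y)"
        by (intro mult_left_mono) auto
      \<comment> \<open>Nonnegativity turns the upper bound into the bound on the absolute value
        that the coefficient estimate asks for.\<close>
      moreover have "0 \<le> poly_eval p (x + t \<cdot>\<^sub>v y)"
        using x y by (intro convex_form_nonneg[OF p d]) simp
      ultimately show ?thesis by linarith
    qed
    then have "\<bar>a d\<bar> \<le> C * (2 ^ (2 * d - 1) * (poly_eval p x + poly_eval p y))"
      by (intro C(2)) blast
    moreover have "a d = real (2 * d choose d) * biform n d p x y"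
      by (simp add: a_def biform_eq[OF form])
    moreover have "1 * \<bar>biform n d p x y\<bar> \<le> real (2 * d choose d) * \<bar>biform n d p x y\<bar>"
      by (intro mult_right_mono) (auto simp: Suc_le_eq)
    ultimately show ?thesis
      by (simp add: abs_mult mult.assoc)
  qed
  with C(1) show ?thesis
    by (intro exI[of _ "C * 2 ^ (2 * d - 1)"]) auto
qed

lemma biform_le_sqrt:
  assumes "d > 0"
  shows "\<exists>A. \<forall>n p. convex_form n (2 * d) p \<longrightarrow> (\<forall>x\<in>carrier_vec n. \<forall>y\<in>carrier_vec n.
    biform n d p x y \<le> A * sqrt (poly_eval p x * poly_eval p y))"
proof -
  obtain K where K: "K \<ge> 0" "\<And>n p x y. convex_form n (2 * d) p \<Longrightarrow> x \<in> carrier_vec n \<Longrightarrow>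
      y \<in> carrier_vec n \<Longrightarrow> biform n d p x y \<le> K * (poly_eval p x + poly_eval p y)"
    using biform_le[OF assms] by blast
  have "biform n d p x y \<le> 2 * K * sqrt (poly_eval p x * poly_eval p y)"
    if p: "convex_form n (2 * d) p" and x: "x \<in> carrier_vec n" and y: "y \<in> carrier_vec n" for n p x y
  proof (rule le_sqrt_mult_of_scaling)
    have form: "is_form n (2 * d) p"
      using p by (simp add: convex_form_def)
    have d: "2 \<le> 2 * d"
      using \<open>d > 0\<close> by simp
    show "0 \<le> poly_eval p x" "0 \<le> poly_eval p y"
      using convex_form_nonneg[OF p d] x y by auto
    show "biform n d p x y \<le> K * (\<mu> * poly_eval p x + poly_eval p y / \<mu>)" if "\<mu> > 0" for \<mu>
    proof -
      \<comment> \<open>Scaling \<open>x\<close> by this \<open>c\<close> multiplies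
        \<open>p\<close> by \<open>\<mu>\<close>, and scaling \<open>y\<close> by its inverse
        divides \<open>p\<close> by \<open>\<mu>\<close>.\<close>
      define c where "c = root (2 * d) \<mu>"
      have c: "c \<noteq> 0" "c ^ (2 * d) = \<mu>"
        using that assms by (auto simp: c_def)
      have "biform n d p x y = biform n d p (c \<cdot>\<^sub>v x) (inverse c \<cdot>\<^sub>v y)"
        using biform_scale[OF form x y c(1)] by simp
      also have "\<dots> \<le> K * (poly_eval p (c \<cdot>\<^sub>v x) + poly_eval p (inverse c \<cdot>\<^sub>v y))"
        using x y by (intro K(2)[OF p]) auto
      also have "\<dots> = K * (\<mu> * poly_eval p x + poly_eval p y / \<mu>)"
        by (simp only: poly_eval_smult[OF form x] poly_eval_smult[OF form y] power_inverse c(2))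
          (simp add: divide_inverse mult.commute)
      finally show ?thesis .
    qed
  qed (use K in simp)
  then show ?thesis by blast
qed

section \<open>The second inequality: averaging over roots of unity\<close>

text \<open>Orthogonality of characters: the sum is a geometric series in \<open>\<omega>\<close>,
  an \<open>N\<close>-th root of unity that differs from 1 when \<open>i\<close> and
  \<open>m\<close> are distinct residues.\<close>

lemma sum_root_unity_mult_cnj:
  assumes "i < N" "m < N"
  defines "\<xi> j \<equiv> cis (2 * pi * real j / real N)"
  shows "(\<Sum>j<N. \<xi> j ^ i * cnj (\<xi> j) ^ m) = (if i = m then of_nat N else 0)"
proof -
  define \<omega> where "\<omega> = \<xi> i * cnj (\<xi> m)"
  have N: "N > 0"
    using assms by simp
  have bij: "bij_betw \<xi> {..<N} {z. z ^ N = 1}"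
    using Complex.bij_betw_roots_unity[OF N] unfolding \<xi>_def[abs_def] .
  \<comment> \<open>Exchanging base and exponent exposes the summand as a \<open>j\<close>-th
    power.\<close>
  have swap: "\<xi> j ^ i = \<xi> i ^ j" for i j
    by (simp add: \<xi>_def Complex.DeMoivre mult_ac)
  have summand: "\<xi> j ^ i * cnj (\<xi> j) ^ m = \<omega> ^ j" for j
    by (simp add: \<omega>_def power_mult_distrib swap[of j] flip: complex_cnj_power)
  have unit: "\<xi> j * cnj (\<xi> j) = 1" for j
    by (simp add: \<xi>_def cis_cnj cis_mult)
  show ?thesis
  proof (cases "i = m")
    case True
    then show ?thesis
      using unit by (simp flip: power_mult_distrib)
  next
    case False
    have "\<omega> \<noteq> 1"
    proof
      assume "\<omega> = 1"
      have "\<xi> i = \<xi> i * cnj (\<xi> m) * \<xi> m"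
        using unit[of m] by (simp add: mult_ac)
      also have "\<dots> = \<xi> m"
        using \<open>\<omega> = 1\<close> by (simp add: \<omega>_def)
      finally show False
        using bij False assms(1,2) by (auto simp: bij_betw_def dest: inj_onD)
    qed
    moreover have "\<xi> j ^ N = 1" if "j < N" for j
      using bij that by (auto simp: bij_betw_def)
    then have "\<omega> ^ N = 1"
      using assms(1,2) by (simp add: \<omega>_def power_mult_distrib flip: complex_cnj_power)
    ultimately have "(\<Sum>j<N. \<omega> ^ j) = 0"
      by (simp add: geometric_sum)
    then show ?thesis
      using False by (simp add: summand)
  qed
qed

lemma poly_eval_of_real:
  assumes p: "is_form n k p" and x: "x \<in> carrier_vec n"
  shows "poly_eval p (map_vec complex_of_real x) = complex_of_real (poly_eval p x)"
  using sym_tensor_of_real[OF p, of "replicate k x"] x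
  by (simp add: vec_tuples_def sym_tensor_diagonal[OF p] subset_iff)

lemma complex_biform_eq:
  "is_form n (2 * d) p \<Longrightarrow>
    complex_biform n d p z w = sym_form n (2 * d) p (replicate d z @ replicate d w)"
  by (simp add: complex_biform_def polar_form_eq complex_extension_sym_form)

text \<open>The Fourier coefficients of a nonnegative trigonometric polynomial are bounded by its
  mean. The samples are \<open>poly_eval p (u j)\<close>, their mean is \<open>c d\<close>, and the
  extreme coefficient \<open>c 0\<close> is \<open>poly_eval p z\<close>.\<close>

lemma cmod_le_complex_biform:
  assumes p: "is_form n (2 * d) p" and nonneg: "\<And>x. x \<in> carrier_vec n \<Longrightarrow> 0 \<le> (poly_eval p x :: real)"
    and z: "z \<in> carrier_vec n"
  shows "cmod (poly_eval p z) \<le> real (2 * d choose d) * Re (complex_biform n d p z (conjugate z))"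
proof -
  \<comment> \<open>The exponents 0 to \<open>2 * d\<close> must stay distinct modulo
    \<open>N\<close>.\<close>
  define N where "N = Suc (2 * d)"
  \<comment> \<open>\<open>w j\<close> is a square root of \<open>cnj (\<xi> j)\<close>, so
    \<open>w j\<close> times \<open>z + \<xi> j \<cdot>\<^sub>v conjugate z\<close> is a vector plus
    its own conjugate, hence real; \<open>u j\<close> is that real vector.\<close>
  define \<xi> w where "\<xi> j = cis (2 * pi * real j / real N)" and "w j = cis (- (pi * real j / real N))" for j
  define u where "u j = vec n (\<lambda>l. 2 * Re (w j * z $ l))" for j
  define c where "c i = of_nat (2 * d choose i) *
    sym_form n (2 * d) p (replicate (2 * d - i) z @ replicate i (conjugate z) @ [])" for i
  have u: "u j \<in> carrier_vec n" for j
    by (simp add: u_def)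
  have z': "conjugate z \<in> carrier_vec n"
    using z by simp
  have unit: "\<xi> j * cnj (\<xi> j) = 1" for j
    by (simp add: \<xi>_def cis_cnj cis_mult)
  have w_\<xi>: "w j * \<xi> j = cnj (w j)" "w j ^ 2 = cnj (\<xi> j)" for j
    by (simp_all add: w_def \<xi>_def cis_cnj cis_mult power2_eq_square mult.assoc)
  have u_eq: "map_vec complex_of_real (u j) = w j \<cdot>\<^sub>v (z + \<xi> j \<cdot>\<^sub>v conjugate z)" for j
  proof (rule eq_vecI)
    fix l
    assume "l < dim_vec (w j \<cdot>\<^sub>v (z + \<xi> j \<cdot>\<^sub>v conjugate z))"
    then have l: "l < n"
      using z by simp
    have "w j * (z $ l + \<xi> j * cnj (z $ l)) = w j * z $ l + (w j * \<xi> j) * cnj (z $ l)"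
      by (simp add: algebra_simps)
    also have "\<dots> = complex_of_real (2 * Re (w j * z $ l))"
      unfolding w_\<xi> using complex_add_cnj[of "w j * z $ l"] by simp
    finally show "map_vec complex_of_real (u j) $ l = (w j \<cdot>\<^sub>v (z + \<xi> j \<cdot>\<^sub>v conjugate z)) $ l"
      using l z by (simp add: u_def)
  qed (use z in \<open>simp add: u_def\<close>)
  have expand: "complex_of_real (poly_eval p (u j)) = cnj (\<xi> j) ^ d * (\<Sum>i\<le>2 * d. c i * \<xi> j ^ i)" for j
  proof -
    have "complex_of_real (poly_eval p (u j)) = w j ^ (2 * d) * poly_eval p (z + \<xi> j \<cdot>\<^sub>v conjugate z)"
      using z z' by (simp add: poly_eval_of_real[OF p u, symmetric] u_eq poly_eval_smult[OF p])
    also have "poly_eval p (z + \<xi> j \<cdot>\<^sub>v conjugate z) = (\<Sum>i\<le>2 * d. c i * \<xi> j ^ i)"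
      using multilinear_form_binomial[OF multilinear_sym_form[OF p] symmetric_sym_form[OF p],
          of "2 * d" "[]" z "conjugate z" "\<xi> j"] z z'
      by (simp add: c_def sym_form_diagonal[OF p])
    finally show ?thesis
      by (simp add: power_mult w_\<xi>)
  qed
  have coeff_sum: "(\<Sum>j<N. \<Sum>i\<le>2 * d. c i * (\<xi> j ^ i * cnj (\<xi> j) ^ m)) = of_nat N * c m" if "m \<le> 2 * d" for m
  proof -
    have "(\<Sum>j<N. \<Sum>i\<le>2 * d. c i * (\<xi> j ^ i * cnj (\<xi> j) ^ m)) =
        (\<Sum>i\<le>2 * d. c i * (\<Sum>j<N. \<xi> j ^ i * cnj (\<xi> j) ^ m))"
      by (subst sum.swap) (simp add: sum_distrib_left)
    also have "\<dots> = (\<Sum>i\<le>2 * d. c i * (if i = m then of_nat N else 0))"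
      using that unfolding \<xi>_def by (intro sum.cong refl, subst sum_root_unity_mult_cnj) (auto simp: N_def)
    also have "\<dots> = of_nat N * c m"
      using that by (simp add: if_distrib[of "(*) _"] mult.commute cong: if_cong)
    finally show ?thesis .
  qed
  \<comment> \<open>The weight \<open>\<xi> j ^ d\<close> cancels the prefactor
    \<open>cnj (\<xi> j) ^ d\<close>, so the sum selects \<open>c 0\<close>.\<close>
  have "(\<Sum>j<N. \<xi> j ^ d * complex_of_real (poly_eval p (u j))) =
      (\<Sum>j<N. \<Sum>i\<le>2 * d. c i * (\<xi> j ^ i * cnj (\<xi> j) ^ 0))"
    by (simp add: expand mult.assoc[symmetric] power_mult_distrib[symmetric] unit)
  also have "\<dots> = of_nat N * c 0"
    by (rule coeff_sum) simp
  also have "c 0 = poly_eval p z"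
    using z by (simp add: c_def sym_form_diagonal[OF p])
  finally have "real N * cmod (poly_eval p z) = cmod (\<Sum>j<N. \<xi> j ^ d * complex_of_real (poly_eval p (u j)))"
    by (simp add: norm_mult)
  \<comment> \<open>The weights have modulus 1 and the values of \<open>p\<close> are nonnegative,
    so the triangle inequality removes the weights.\<close>
  also have "\<dots> \<le> (\<Sum>j<N. poly_eval p (u j))"
    using nonneg u by (intro sum_norm_le) (simp add: norm_mult norm_power \<xi>_def)
  also have "\<dots> = Re (\<Sum>j<N. complex_of_real (poly_eval p (u j)))"
    by simp
  \<comment> \<open>Without a weight the prefactor remains and selects the middle coefficient
    \<open>c d\<close>.\<close>
  also have "(\<Sum>j<N. complex_of_real (poly_eval p (u j))) =
      (\<Sum>j<N. \<Sum>i\<le>2 * d. c i * (\<xi> j ^ i * cnj (\<xi> j) ^ d))"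
    by (simp add: expand sum_distrib_left mult_ac)
  also have "\<dots> = of_nat N * c d"
    by (rule coeff_sum) simp
  also have "c d = of_nat (2 * d choose d) * complex_biform n d p z (conjugate z)"
    by (simp add: c_def complex_biform_eq[OF p])
  finally have "real N * cmod (poly_eval p z) \<le>
      real N * (real (2 * d choose d) * Re (complex_biform n d p z (conjugate z)))"
    by simp
  then show ?thesis
    by (simp add: N_def)
qed

theorem theorem3p1:
  fixes d :: nat
  assumes "d > 0"
  shows "\<exists>A B :: real. \<forall>n > 0. \<forall>p. convex_form n (2 * d) p \<longrightarrow>
    (\<forall>x\<in>carrier_vec n. \<forall>y\<in>carrier_vec n.
       biform n d p x y \<le> A * sqrt (poly_eval p x * poly_eval p y)) \<and>
    (\<forall>z\<in>carrier_vec n.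
       cmod (poly_eval p z) \<le> B * Re (complex_biform n d p z (conjugate z)))"
proof -
  obtain A where A: "\<And>n p x y. convex_form n (2 * d) p \<Longrightarrow> x \<in> carrier_vec n \<Longrightarrow>
      y \<in> carrier_vec n \<Longrightarrow> biform n d p x y \<le> A * sqrt (poly_eval p x * poly_eval p y)"
    using biform_le_sqrt[OF assms] by blast
  have B: "cmod (poly_eval p z) \<le> real (2 * d choose d) * Re (complex_biform n d p z (conjugate z))"
    if p: "convex_form n (2 * d) p" and "z \<in> carrier_vec n" for n p z
  proof (rule cmod_le_complex_biform)
    show "is_form n (2 * d) p"
      using p by (simp add: convex_form_def)
    show "0 \<le> (poly_eval p x :: real)" if "x \<in> carrier_vec n" for x
      using convex_form_nonneg[OF p _ that] assms by simp
  qed fact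
  show ?thesis
    by (intro exI[of _ A] exI[of _ "real (2 * d choose d)"] allI impI conjI ballI) (use A B in blast)+
qed

end
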